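(* For any real $\alpha\ge1$, $\langle\mathcal{MON}_\alpha\rangle_\omega=\mathcal{MON}_\alpha$ and $\mathcal{B}_0\subseteq\mathcal{MON}_\alpha$.
   Context: $\mathcal{B}_k$ is the set of functions $\{0,1\}^k\to\mathbb{R}_{\ge0}$, $\mathcal{B}=\bigcup_k\mathcal{B}_k$. $\mathrm{EQ}$ is the binary equality indicator. $\langle\mathcal{F}\rangle$ is the closure of $\mathcal{F}\cup\{\mathrm{EQ}\}$ under introducing fictitious arguments, permuting arguments, pointwise product of equal-arity functions, and summing out an argument over $\{0,1\}$; a $k$-ary $f$ is a limit of $\mathcal{F}$ if there is a finite $S\subseteq\mathcal{F}$ such that for all $\epsilon>0$ some $k$-ary $f_\epsilon\in\langle S\rangle$ has $\max_\mathbf{x}|f-f_\epsilon|<\epsilon$; $\langle\mathcal{F}\rangle_\omega$ is the closure of $\mathcal{F}\cup\{\mathrm{EQ}\}$ under the four operations and limits. For $f\in\mathcal{B}_n$, define the equivalence relation $\sim_f$ on $[n]$ by $i\sim_f j$ iff $f(\mathbf{x})=0$ for every $\mathbf{x}\in\{0,1\}^n$ with $x_i\ne x_j$. If $V_1,\dots,V_\ell$ are its classes, $\tilde f\in\mathcal{B}_\ell$ is $\tilde f(\mathbf{x})=f(\mathbf{y})$ where $y_i=x_j$ whenever $i\in V_j$. An argument $x_i$ of $f\in\mathcal{B}_n$ is fictitious if $f(\mathbf{x})=f(\mathbf{x}')$ whenever $\mathbf{x},\mathbf{x}'$ differ only in position $i$. For $\alpha\ge0$, $f\in\mathcal{B}_n$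 is $\alpha$-monotone if for every non-fictitious argument $x_i$ and every $\mathbf{x}$ with $x_i=0$, $\alpha f(\mathbf{x})\le f(x_1,\dots,x_{i-1},1,x_{i+1},\dots,x_n)$. $f$ is block-$\alpha$-monotone if $\tilde f$ is $\alpha$-monotone, and $\mathcal{MON}_\alpha$ is the set of all block-$\alpha$-monotone functions in $\mathcal{B}$. *)

theory Defs
  imports Complex_Main "HOL-Library.FuncSet" "HOL-Combinatorics.Permutations"
begin

text \<open>
  A point of $\{0,1\}^k$ is a boolean list of length \<open>k\<close>, positions being numbered from 0.
  A function carries its arity explicitly, and is \<open>undefined\<close> on lists of any other length
  (as in \<^theory>\<open>HOL-Library.FuncSet\<close>), so that equality of pairs is
  equality of functions on the cube.
\<close>

type_synonym bfun = "nat \<times> (bool list \<Rightarrow> real)"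

definition cube :: "nat \<Rightarrow> bool list set" where
  "cube k = {x. length x = k}"

definition bfuns :: "nat \<Rightarrow> bfun set" where
  "bfuns k = {k} \<times> (cube k \<rightarrow>\<^sub>E {0..})"

definition all_bfuns :: "bfun set" where
  "all_bfuns = (\<Union>k. bfuns k)"

definition mk_bfun :: "nat \<Rightarrow> (bool list \<Rightarrow> real) \<Rightarrow> bfun" where
  "mk_bfun k f = (k, restrict f (cube k))"

definition EQ :: bfun where
  "EQ = mk_bfun 2 (\<lambda>x. if x ! 0 = x ! 1 then 1 else 0)"


subsection \<open>Functional clones\<close>

definition add_arg :: "nat \<Rightarrow> bfun \<Rightarrow> bfun" where
  "add_arg i f = mk_bfun (Suc (fst f)) (\<lambda>x. snd f (take i x @ drop (Suc i) x))"

definition permute_args :: "(nat \<Rightarrow> nat) \<Rightarrow> bfun \<Rightarrow> bfun" where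
  "permute_args p f = mk_bfun (fst f) (\<lambda>x. snd f (permute_list p x))"

definition mult_bfun :: "bfun \<Rightarrow> bfun \<Rightarrow> bfun" where
  "mult_bfun f g = mk_bfun (fst f) (\<lambda>x. snd f x * snd g x)"

definition sum_out :: "nat \<Rightarrow> bfun \<Rightarrow> bfun" where
  "sum_out i f = mk_bfun (fst f - 1) (\<lambda>x. \<Sum>b\<in>UNIV. snd f (take i x @ b # drop i x))"

inductive_set clone :: "bfun set \<Rightarrow> bfun set" for F where
  base: "f \<in> F \<Longrightarrow> f \<in> clone F"
| EQ: "EQ \<in> clone F"
| add_arg: "f \<in> clone F \<Longrightarrow> i \<le> fst f \<Longrightarrow> add_arg i f \<in> clone F"
| permute_args: "f \<in> clone F \<Longrightarrow> p permutes {..<fst f} \<Longrightarrow> permute_args p f \<in> clone F"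
| mult: "f \<in> clone F \<Longrightarrow> g \<in> clone F \<Longrightarrow> fst f = fst g \<Longrightarrow> mult_bfun f g \<in> clone F"
| sum_out: "f \<in> clone F \<Longrightarrow> i < fst f \<Longrightarrow> sum_out i f \<in> clone F"

definition approximable :: "bfun set \<Rightarrow> bfun \<Rightarrow> bool" where
  "approximable S f \<longleftrightarrow>
     (\<forall>\<epsilon>>0. \<exists>g \<in> clone S. fst g = fst f \<and>
        Max ((\<lambda>x. \<bar>snd f x - snd g x\<bar>) ` cube (fst f)) < \<epsilon>)"

definition is_limit :: "bfun set \<Rightarrow> bfun \<Rightarrow> bool" where
  "is_limit F f \<longleftrightarrow> f \<in> all_bfuns \<and> (\<exists>S. finite S \<and> S \<subseteq> F \<and> approximable S f)"

inductive_set omega_clone :: "bfun set \<Rightarrow> bfun set" for F where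
  base: "f \<in> F \<Longrightarrow> f \<in> omega_clone F"
| EQ: "EQ \<in> omega_clone F"
| add_arg: "f \<in> omega_clone F \<Longrightarrow> i \<le> fst f \<Longrightarrow> add_arg i f \<in> omega_clone F"
| permute_args: "f \<in> omega_clone F \<Longrightarrow> p permutes {..<fst f} \<Longrightarrow> permute_args p f \<in> omega_clone F"
| mult: "f \<in> omega_clone F \<Longrightarrow> g \<in> omega_clone F \<Longrightarrow> fst f = fst g \<Longrightarrow>
           mult_bfun f g \<in> omega_clone F"
| sum_out: "f \<in> omega_clone F \<Longrightarrow> i < fst f \<Longrightarrow> sum_out i f \<in> omega_clone F"
| limit: "f \<in> all_bfuns \<Longrightarrow> finite S \<Longrightarrow> \<forall>s \<in> S. s \<in> omega_clone F \<Longrightarrow>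
            approximable S f \<Longrightarrow> f \<in> omega_clone F"

lemma omega_clone_limit: "is_limit (omega_clone F) f \<Longrightarrow> f \<in> omega_clone F"
  unfolding is_limit_def by (auto intro: omega_clone.limit)


subsection \<open>Block-monotone functions\<close>

definition arg_rel :: "bfun \<Rightarrow> (nat \<times> nat) set" where
  "arg_rel f = {(i, j). i < fst f \<and> j < fst f \<and>
     (\<forall>x \<in> cube (fst f). x ! i \<noteq> x ! j \<longrightarrow> snd f x = 0)}"

lemma equiv_arg_rel: "equiv {..<fst f} (arg_rel f)"
proof (rule equivI)
  show "arg_rel f \<subseteq> {..<fst f} \<times> {..<fst f}" by (auto simp: arg_rel_def)
  show "refl_on {..<fst f} (arg_rel f)" by (auto simp: arg_rel_def refl_on_def)
  show "sym (arg_rel f)" by (auto simp: arg_rel_def sym_def)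
  show "trans (arg_rel f)" unfolding arg_rel_def trans_def by simp metis
qed

text \<open>
  The classes $V_1,\dots,V_\ell$, enumerated by increasing least element; the ordering is
  immaterial for monotonicity.
\<close>

definition blocks :: "bfun \<Rightarrow> nat set list" where
  "blocks f = map (\<lambda>i. arg_rel f `` {i})
                (filter (\<lambda>i. \<forall>j<i. (j, i) \<notin> arg_rel f) [0..<fst f])"

lemma set_blocks: "set (blocks f) = {..<fst f} // arg_rel f"
proof
  show "set (blocks f) \<subseteq> {..<fst f} // arg_rel f"
    by (auto simp: blocks_def quotient_def)
  show "{..<fst f} // arg_rel f \<subseteq> set (blocks f)"
  proof
    fix V assume "V \<in> {..<fst f} // arg_rel f"
    then obtain i where i: "i < fst f" "V = arg_rel f `` {i}"
      by (auto elim!: quotientE)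
    define m where "m = (LEAST j. (j, i) \<in> arg_rel f)"
    have "(i, i) \<in> arg_rel f" using i by (simp add: arg_rel_def)
    then have m: "(m, i) \<in> arg_rel f" unfolding m_def by (rule LeastI)
    have "(j, m) \<notin> arg_rel f" if "j < m" for j
      using not_less_Least[of j "\<lambda>j. (j, i) \<in> arg_rel f"] that m equiv_arg_rel[of f]
      unfolding m_def[symmetric] by (meson equivE transE)
    moreover have "arg_rel f `` {m} = V"
      using equiv_class_eq[OF equiv_arg_rel m] i by simp
    moreover have "m < fst f" using m by (simp add: arg_rel_def)
    ultimately show "V \<in> set (blocks f)" unfolding blocks_def by force
  qed
qed

lemma distinct_blocks: "distinct (blocks f)"
proof -
  have "a = b" if "a < fst f" "b < fst f" "\<forall>j<a. (j, a) \<notin> arg_rel f"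
    "\<forall>j<b. (j, b) \<notin> arg_rel f" "arg_rel f `` {a} = arg_rel f `` {b}" for a b
  proof -
    have "(a, b) \<in> arg_rel f"
      using eq_equiv_class[OF that(5) equiv_arg_rel] that(2) by simp
    moreover have "(b, a) \<in> arg_rel f"
      using eq_equiv_class[OF that(5)[symmetric] equiv_arg_rel] that(1) by simp
    ultimately show ?thesis using that(3,4) by (metis linorder_neqE_nat)
  qed
  then show ?thesis by (auto simp: blocks_def distinct_map inj_on_def)
qed

definition block_index :: "bfun \<Rightarrow> nat \<Rightarrow> nat" where
  "block_index f i = (THE j. j < length (blocks f) \<and> i \<in> blocks f ! j)"

definition collapse :: "bfun \<Rightarrow> bfun" where
  "collapse f = mk_bfun (length (blocks f))
     (\<lambda>x. snd f (map (\<lambda>i. x ! block_index f i) [0..<fst f]))"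

definition fictitious :: "bfun \<Rightarrow> nat \<Rightarrow> bool" where
  "fictitious f i \<longleftrightarrow>
     (\<forall>x \<in> cube (fst f). \<forall>x' \<in> cube (fst f).
        (\<forall>j < fst f. j \<noteq> i \<longrightarrow> x ! j = x' ! j) \<longrightarrow> snd f x = snd f x')"

definition monotone_fun :: "real \<Rightarrow> bfun \<Rightarrow> bool" where
  "monotone_fun \<alpha> f \<longleftrightarrow>
     (\<forall>i < fst f. \<not> fictitious f i \<longrightarrow>
        (\<forall>x \<in> cube (fst f). \<not> x ! i \<longrightarrow> \<alpha> * snd f x \<le> snd f (x[i := True])))"

definition block_monotone :: "real \<Rightarrow> bfun \<Rightarrow> bool" where
  "block_monotone \<alpha> f \<longleftrightarrow> monotone_fun \<alpha> (collapse f)"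

definition MON :: "real \<Rightarrow> bfun set" where
  "MON \<alpha> = {f \<in> all_bfuns. block_monotone \<alpha> f}"

end

theory Submission
  imports Defs
begin

text \<open>
  Call a set of arguments saturated if it is a union of classes of \<open>\<sim>\<^sub>f\<close>. Since \<open>\<alpha> \<ge> 1\<close>,
  raising the classes of a saturated set \<open>V\<close> one at a time from 0 to 1 shows that \<open>f\<close> is
  block-\<open>\<alpha>\<close>-monotone iff for every saturated \<open>V\<close>, raising \<open>V\<close> either never changes \<open>f\<close> or
  always multiplies it by at least \<open>\<alpha>\<close>. In this form the closure properties are direct:
  every operation turns a saturated set of the result into saturated sets of the operands.
  For a limit \<open>f\<close>, every approximant \<open>g\<close> that is close enough to be nonzero wherever
  \<open>f\<close> is nonzero has \<open>\<sim>\<^sub>g\<close> contained in \<open>\<sim>\<^sub>f\<close>, so sets saturated for \<open>f\<close> are saturated for \<open>g\<close>.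
\<close>

section \<open>Functions on the cube\<close>

lemma finite_cube: "finite (cube k)"
  using finite_lists_length_eq[of "UNIV :: bool set" k] by (simp add: cube_def)

lemma fst_mk_bfun [simp]: "fst (mk_bfun k f) = k"
  by (simp add: mk_bfun_def)

lemma snd_mk_bfun: "x \<in> cube k \<Longrightarrow> snd (mk_bfun k f) x = f x"
  by (simp add: mk_bfun_def)

lemma all_bfuns_nonneg: "f \<in> all_bfuns \<Longrightarrow> x \<in> cube (fst f) \<Longrightarrow> 0 \<le> snd f x"
  by (auto simp: all_bfuns_def bfuns_def)

lemma mk_bfun_in_all_bfuns:
  assumes "\<And>x. x \<in> cube k \<Longrightarrow> 0 \<le> f x"
  shows "mk_bfun k f \<in> all_bfuns"
  using assms by (auto simp: all_bfuns_def bfuns_def mk_bfun_def)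

lemma arg_relI:
  assumes "i < fst f" "j < fst f"
    and "\<And>x. x \<in> cube (fst f) \<Longrightarrow> x ! i \<noteq> x ! j \<Longrightarrow> snd f x = 0"
  shows "(i, j) \<in> arg_rel f"
  using assms by (simp add: arg_rel_def)

lemma arg_relD:
  assumes "(i, j) \<in> arg_rel f"
  shows "i < fst f" "j < fst f"
    and "\<And>x. x \<in> cube (fst f) \<Longrightarrow> x ! i \<noteq> x ! j \<Longrightarrow> snd f x = 0"
  using assms by (auto simp: arg_rel_def)


section \<open>Raising saturated sets of arguments\<close>

definition raise_args :: "nat set \<Rightarrow> bool list \<Rightarrow> bool list" where
  "raise_args V x = map (\<lambda>j. j \<in> V \<or> x ! j) [0..<length x]"

lemma length_raise_args [simp]: "length (raise_args V x) = length x"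
  by (simp add: raise_args_def)

lemma nth_raise_args [simp]: "j < length x \<Longrightarrow> raise_args V x ! j \<longleftrightarrow> j \<in> V \<or> x ! j"
  by (simp add: raise_args_def)

lemma raise_args_in_cube [simp]: "raise_args V x \<in> cube k \<longleftrightarrow> x \<in> cube k"
  by (simp add: cube_def)

lemma raise_args_empty [simp]: "raise_args {} x = x"
  by (simp add: list_eq_iff_nth_eq)

lemma raise_args_Un: "raise_args (V \<union> W) x = raise_args W (raise_args V x)"
  by (auto simp: list_eq_iff_nth_eq)

definition vanishing :: "nat set \<Rightarrow> nat \<Rightarrow> bool list set" where
  "vanishing V k = {x \<in> cube k. \<forall>i\<in>V. \<not> x ! i}"

lemma vanishingD: "x \<in> vanishing V k \<Longrightarrow> x \<in> cube k"
  by (simp add: vanishing_def)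

definition saturated :: "bfun \<Rightarrow> nat set \<Rightarrow> bool" where
  "saturated f V \<longleftrightarrow> V \<subseteq> {..<fst f} \<and> arg_rel f `` V \<subseteq> V"

text \<open>The counterpart of \<open>fictitious\<close> for arguments that move together: only the
  all-0 and all-1 settings of \<open>V\<close> are compared. On a single class the mixed settings
  have value 0 anyway.\<close>

definition raise_invariant :: "bfun \<Rightarrow> nat set \<Rightarrow> bool" where
  "raise_invariant f V \<longleftrightarrow> (\<forall>x \<in> vanishing V (fst f). snd f (raise_args V x) = snd f x)"

definition raise_expanding :: "real \<Rightarrow> bfun \<Rightarrow> nat set \<Rightarrow> bool" where
  "raise_expanding \<alpha> f V \<longleftrightarrow>
     (\<forall>x \<in> vanishing V (fst f). \<alpha> * snd f x \<le> snd f (raise_args V x))"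

definition saturated_monotone :: "real \<Rightarrow> bfun \<Rightarrow> bool" where
  "saturated_monotone \<alpha> f \<longleftrightarrow>
     (\<forall>V. saturated f V \<longrightarrow> raise_invariant f V \<or> raise_expanding \<alpha> f V)"

lemma raise_invariant_empty: "raise_invariant f {}"
  by (simp add: raise_invariant_def)

text \<open>Invariance gives equality; expansion gives the inequality because \<alpha> \<ge> 1 and
  the values are nonnegative.\<close>

lemma raise_mono:
  assumes "f \<in> all_bfuns" "\<alpha> \<ge> 1" "raise_invariant f V \<or> raise_expanding \<alpha> f V"
    and "x \<in> vanishing V (fst f)"
  shows "snd f x \<le> snd f (raise_args V x)"
  using assms(3)
proof
  assume "raise_expanding \<alpha> f V"
  then have "\<alpha> * snd f x \<le> snd f (raise_args V x)"
    using assms(4) by (simp add: raise_expanding_def)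
  moreover have "1 * snd f x \<le> \<alpha> * snd f x"
    using assms by (intro mult_right_mono all_bfuns_nonneg) (auto simp: vanishing_def)
  ultimately show ?thesis by simp
qed (use assms(4) in \<open>simp add: raise_invariant_def\<close>)

text \<open>Raise \<open>V\<close> first, then \<open>W\<close>. If one of the steps expands, it
  supplies the factor \<alpha>, and the other step loses nothing by \<open>raise_mono\<close>; two
  invariant steps compose to an invariant one.\<close>

lemma raise_Un:
  assumes f: "f \<in> all_bfuns" and \<alpha>: "\<alpha> \<ge> 1" and VW: "V \<inter> W = {}" "W \<subseteq> {..<fst f}"
    and V: "raise_invariant f V \<or> raise_expanding \<alpha> f V"
    and W: "raise_invariant f W \<or> raise_expanding \<alpha> f W"
  shows "raise_invariant f (V \<union> W) \<or> raise_expanding \<alpha> f (V \<union> W)"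
proof -
  \<comment> \<open>Disjointness keeps \<open>W\<close> at 0 while \<open>V\<close> is
    raised.\<close>
  have x: "x \<in> vanishing V (fst f)" "raise_args V x \<in> vanishing W (fst f)"
    if "x \<in> vanishing (V \<union> W) (fst f)" for x
    using that VW by (auto simp: vanishing_def cube_def subset_iff)
  consider "raise_invariant f V" "raise_invariant f W" | "raise_expanding \<alpha> f V"
    | "raise_invariant f V" "raise_expanding \<alpha> f W"
    using V W by blast
  then show ?thesis
  proof cases
    case 1
    then have "raise_invariant f (V \<union> W)"
      using x by (simp add: raise_invariant_def raise_args_Un)
    then show ?thesis ..
  next
    case 2
    have "raise_expanding \<alpha> f (V \<union> W)"
      unfolding raise_expanding_def raise_args_Un
    proof
      fix y assume y: "y \<in> vanishing (V \<union> W) (fst f)"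
      have "\<alpha> * snd f y \<le> snd f (raise_args V y)"
        using 2 x(1)[OF y] by (simp add: raise_expanding_def)
      also have "\<dots> \<le> snd f (raise_args W (raise_args V y))"
        by (rule raise_mono[OF f \<alpha> W x(2)[OF y]])
      finally show "\<alpha> * snd f y \<le> snd f (raise_args W (raise_args V y))" .
    qed
    then show ?thesis ..
  next
    case 3
    have "raise_expanding \<alpha> f (V \<union> W)"
      unfolding raise_expanding_def raise_args_Un
    proof
      fix y assume y: "y \<in> vanishing (V \<union> W) (fst f)"
      have "snd f (raise_args V y) = snd f y"
        using 3(1) x(1)[OF y] by (simp add: raise_invariant_def)
      moreover have "\<alpha> * snd f (raise_args V y) \<le> snd f (raise_args W (raise_args V y))"
        using 3(2) x(2)[OF y] by (simp add: raise_expanding_def)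
      ultimately show "\<alpha> * snd f y \<le> snd f (raise_args W (raise_args V y))" by simp
    qed
    then show ?thesis ..
  qed
qed


section \<open>Block-monotonicity and saturated sets\<close>

text \<open>Classes are disjoint, cover all positions and are listed without repetition, so the
  definite description in \<open>block_index\<close> has a unique solution.\<close>

lemma block_index:
  assumes "i < fst f" "k < length (blocks f)"
  shows "i \<in> blocks f ! k \<longleftrightarrow> block_index f i = k"
proof -
  have disj: "k = l" if "k < length (blocks f)" "l < length (blocks f)"
    "i \<in> blocks f ! k" "i \<in> blocks f ! l" for k l
  proof -
    have "blocks f ! k \<in> {..<fst f} // arg_rel f" "blocks f ! l \<in> {..<fst f} // arg_rel f"
      using that set_blocks[of f] nth_mem by blast+
    then have "blocks f ! k = blocks f ! l"
      using quotient_disj[OF equiv_arg_rel] that(3,4) by blast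
    then show ?thesis using distinct_blocks[of f] that(1,2) by (simp add: nth_eq_iff_index_eq)
  qed
  have "i \<in> \<Union>(set (blocks f))"
    using assms(1) Union_quotient[OF equiv_arg_rel, of f] by (simp add: set_blocks)
  then obtain l where l: "l < length (blocks f)" "i \<in> blocks f ! l"
    by (auto simp: in_set_conv_nth)
  then have "block_index f i = l"
    unfolding block_index_def by (intro the_equality) (use disj in blast)+
  then show ?thesis using l disj assms by auto
qed

lemma block_index_less:
  assumes "i < fst f"
  shows "block_index f i < length (blocks f)"
proof -
  have "i \<in> \<Union>(set (blocks f))"
    using assms Union_quotient[OF equiv_arg_rel, of f] by (simp add: set_blocks)
  then show ?thesis using block_index[OF assms] by (auto simp: in_set_conv_nth)
qed

lemma nth_blocks:
  assumes "k < length (blocks f)"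
  shows "blocks f ! k = {i. i < fst f \<and> block_index f i = k}" and "blocks f ! k \<noteq> {}"
proof -
  have mem: "blocks f ! k \<in> {..<fst f} // arg_rel f"
    using assms set_blocks[of f] nth_mem by blast
  then have "blocks f ! k \<subseteq> {..<fst f}"
    using Union_quotient[OF equiv_arg_rel, of f] by blast
  then show "blocks f ! k = {i. i < fst f \<and> block_index f i = k}"
    using block_index[OF _ assms] by auto
  show "blocks f ! k \<noteq> {}"
    using in_quotient_imp_non_empty[OF equiv_arg_rel mem] .
qed

lemma block_index_eq_iff:
  assumes "i < fst f" "j < fst f"
  shows "block_index f i = block_index f j \<longleftrightarrow> (i, j) \<in> arg_rel f"
proof -
  let ?B = "blocks f ! block_index f i"
  have B: "?B \<in> {..<fst f} // arg_rel f"
    using block_index_less[OF assms(1)] set_blocks[of f] nth_mem by blast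
  have i: "i \<in> ?B" using block_index[OF assms(1) block_index_less[OF assms(1)]] by simp
  have "j \<in> ?B \<longleftrightarrow> (i, j) \<in> arg_rel f"
    using in_quotient_imp_in_rel[OF equiv_arg_rel B, of i j]
      in_quotient_imp_closed[OF equiv_arg_rel B i] i by blast
  then show ?thesis using block_index[OF assms(2) block_index_less[OF assms(1)]] by auto
qed

lemma saturated_block:
  assumes "k < length (blocks f)"
  shows "saturated f (blocks f ! k)"
proof -
  have "j < fst f \<and> block_index f j = block_index f i" if "(i, j) \<in> arg_rel f" for i j
    using arg_relD(1,2)[OF that] block_index_eq_iff[of i f j] that by simp
  then show ?thesis unfolding saturated_def nth_blocks(1)[OF assms] by blast
qed

section \<open>Points that are constant on every class\<close>

definition expand :: "bfun \<Rightarrow> bool list \<Rightarrow> bool list" where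
  "expand f y = map (\<lambda>i. y ! block_index f i) [0..<fst f]"

lemma expand_in_cube [simp]: "expand f y \<in> cube (fst f)"
  by (simp add: expand_def cube_def)

lemma nth_expand [simp]: "i < fst f \<Longrightarrow> expand f y ! i = y ! block_index f i"
  by (simp add: expand_def)

lemma length_expand [simp]: "length (expand f y) = fst f"
  by (simp add: expand_def)

lemma snd_collapse:
  "y \<in> cube (length (blocks f)) \<Longrightarrow> snd (collapse f) y = snd f (expand f y)"
  by (simp add: collapse_def snd_mk_bfun expand_def)

lemma fst_collapse [simp]: "fst (collapse f) = length (blocks f)"
  by (simp add: collapse_def)

text \<open>The link between the two forms of monotonicity: one coordinate of the collapsed cube
  governs a whole class.\<close>

lemma expand_update:
  assumes "y \<in> cube (length (blocks f))" "k < length (blocks f)"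
  shows "expand f (y[k := True]) = raise_args (blocks f ! k) (expand f y)"
  using assms block_index_less[of _ f]
  by (auto simp: list_eq_iff_nth_eq nth_blocks(1) cube_def nth_list_update)

lemma expand_vanishing:
  assumes "k < length (blocks f)"
  shows "expand f y \<in> vanishing (blocks f ! k) (fst f) \<longleftrightarrow> \<not> y ! k"
  \<comment> \<open>Nonemptiness of the class is what gives the forward direction.\<close>
  using nth_blocks[OF assms] by (auto simp: vanishing_def)

text \<open>Let coordinate \<open>k\<close> of \<open>y\<close> be the value of \<open>x\<close> at
  any member of class \<open>k\<close>; as \<open>x\<close> is constant on classes, the choice does
  not matter.\<close>

lemma expand_surj:
  assumes "x \<in> cube (fst f)"
    and "\<And>i j. (i, j) \<in> arg_rel f \<Longrightarrow> x ! i = x ! j"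
  obtains y where "y \<in> cube (length (blocks f))" "x = expand f y"
proof
  let ?y = "map (\<lambda>k. x ! (SOME i. i \<in> blocks f ! k)) [0..<length (blocks f)]"
  show "?y \<in> cube (length (blocks f))" by (simp add: cube_def)
  have "x ! i = expand f ?y ! i" if i: "i < fst f" for i
  proof -
    have less: "block_index f i < length (blocks f)" using i by (rule block_index_less)
    let ?j = "SOME j. j \<in> blocks f ! block_index f i"
    have "?j \<in> blocks f ! block_index f i"
      using nth_blocks(2)[OF less] by (simp add: some_in_eq)
    then have "(i, ?j) \<in> arg_rel f"
      using i block_index_eq_iff[of i f ?j] by (simp add: nth_blocks(1)[OF less])
    then have "x ! i = x ! ?j" by (rule assms(2))
    also have "\<dots> = expand f ?y ! i" using i less by simp
    finally show ?thesis .
  qed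
  then show "x = expand f ?y"
    using assms(1) by (intro nth_equalityI) (simp_all add: cube_def)
qed

text \<open>At a point that is not constant on classes, \<open>f\<close> is 0 both before and after
  raising, so only points of the form \<open>expand f y\<close> matter. There a fictitious argument
  of \<open>collapse f\<close> yields invariance and any other argument yields expansion.\<close>

lemma monotone_collapse_block:
  assumes f: "f \<in> all_bfuns" and mono: "monotone_fun \<alpha> (collapse f)"
    and k: "k < length (blocks f)"
  shows "raise_invariant f (blocks f ! k) \<or> raise_expanding \<alpha> f (blocks f ! k)"
proof -
  let ?V = "blocks f ! k"
  have cases: "(snd f x = 0 \<and> snd f (raise_args ?V x) = 0) \<or>
      (\<exists>y. y \<in> cube (length (blocks f)) \<and> \<not> y ! k \<and> x = expand f y)"
    if x: "x \<in> vanishing ?V (fst f)" for x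
  proof (cases "\<forall>i j. (i, j) \<in> arg_rel f \<longrightarrow> x ! i = x ! j")
    case True
    obtain y where "y \<in> cube (length (blocks f))" "x = expand f y"
      using expand_surj[OF vanishingD[OF x]] True by blast
    then show ?thesis using x expand_vanishing[OF k] by blast
  next
    case False
    then obtain i j where ij: "(i, j) \<in> arg_rel f" "x ! i \<noteq> x ! j" by blast
    have len: "x \<in> cube (fst f)" using x by (rule vanishingD)
    \<comment> \<open>Related arguments lie both inside or both outside \<open>?V\<close>. Inside,
      \<open>x\<close> would be 0 at both; hence they lie outside, and their disagreement survives
      the raising.\<close>
    have "i \<in> ?V \<longleftrightarrow> j \<in> ?V"
      using ij(1) arg_relD(1,2)[OF ij(1)] block_index_eq_iff[of i f j]
      by (simp add: nth_blocks(1)[OF k])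
    moreover have "i \<in> ?V \<Longrightarrow> \<not> x ! i" "j \<in> ?V \<Longrightarrow> \<not> x ! j"
      using x by (auto simp: vanishing_def)
    ultimately have "raise_args ?V x ! i \<noteq> raise_args ?V x ! j"
      using ij arg_relD(1,2)[OF ij(1)] len by (auto simp: cube_def)
    then show ?thesis using ij arg_relD(3)[OF ij(1)] len by simp
  qed
  show ?thesis
  proof (cases "fictitious (collapse f) k")
    case True
    have "raise_invariant f ?V"
      unfolding raise_invariant_def
    proof
      fix x assume "x \<in> vanishing ?V (fst f)"
      from cases[OF this] show "snd f (raise_args ?V x) = snd f x"
      proof (elim disjE exE conjE)
        fix y assume y: "y \<in> cube (length (blocks f))" "x = expand f y"
        have y': "y[k := True] \<in> cube (length (blocks f))" using y by (simp add: cube_def)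
        have "snd (collapse f) (y[k := True]) = snd (collapse f) y"
          by (rule True[unfolded fictitious_def fst_collapse, rule_format])
            (use y y' in simp_all)
        then show ?thesis using y y' expand_update[OF y(1) k] by (simp add: snd_collapse)
      qed simp
    qed
    then show ?thesis ..
  next
    case False
    have "raise_expanding \<alpha> f ?V"
      unfolding raise_expanding_def
    proof
      fix x assume "x \<in> vanishing ?V (fst f)"
      from cases[OF this] show "\<alpha> * snd f x \<le> snd f (raise_args ?V x)"
      proof (elim disjE exE conjE)
        fix y assume y: "y \<in> cube (length (blocks f))" "x = expand f y" "\<not> y ! k"
        have y': "y[k := True] \<in> cube (length (blocks f))" using y by (simp add: cube_def)
        have "\<alpha> * snd (collapse f) y \<le> snd (collapse f) (y[k := True])"
          using mono False y k unfolding monotone_fun_def by simp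
        then show ?thesis using y y' expand_update[OF y(1) k] by (simp add: snd_collapse)
      qed simp
    qed
    then show ?thesis ..
  qed
qed

lemma block_monotone_imp_saturated_monotone:
  assumes f: "f \<in> all_bfuns" and \<alpha>: "\<alpha> \<ge> 1" and mono: "block_monotone \<alpha> f"
  shows "saturated_monotone \<alpha> f"
  unfolding saturated_monotone_def
proof (intro allI impI)
  fix V assume V: "saturated f V"
  \<comment> \<open>\<open>?U K\<close> is the union of the classes with index in \<open>K\<close>;
    classes are added one at a time by \<open>raise_Un\<close>.\<close>
  let ?U = "\<lambda>K. {i. i < fst f \<and> block_index f i \<in> K}"
  have U: "raise_invariant f (?U K) \<or> raise_expanding \<alpha> f (?U K)"
    if "finite K" "K \<subseteq> {..<length (blocks f)}" for K
    using that
  proof (induction K rule: finite_induct)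
    case (insert k K)
    have "?U (insert k K) = ?U K \<union> blocks f ! k"
      using insert.prems by (auto simp: nth_blocks(1))
    moreover have "?U K \<inter> blocks f ! k = {}" "blocks f ! k \<subseteq> {..<fst f}"
      using insert.prems insert.hyps by (auto simp: nth_blocks(1))
    ultimately show ?case
      using raise_Un[OF f \<alpha>] insert.IH insert.prems
        monotone_collapse_block[OF f mono[unfolded block_monotone_def]]
      by simp
  qed (simp add: raise_invariant_empty)
  \<comment> \<open>A saturated set is the union of the classes that it meets.\<close>
  have "V = ?U (block_index f ` V)"
  proof (intro equalityI subsetI)
    fix i assume "i \<in> ?U (block_index f ` V)"
    then obtain j where "i < fst f" "j \<in> V" "block_index f i = block_index f j" by auto
    moreover from this have "j < fst f" using V by (auto simp: saturated_def)
    ultimately show "i \<in> V"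
      using V block_index_eq_iff[of j f i] by (auto simp: saturated_def)
  qed (use V in \<open>auto simp: saturated_def\<close>)
  moreover have K: "block_index f ` V \<subseteq> {..<length (blocks f)}"
    using V block_index_less[of _ f] by (auto simp: saturated_def)
  ultimately show "raise_invariant f V \<or> raise_expanding \<alpha> f V"
    using U[OF finite_subset[OF K finite_lessThan] K] by metis
qed

text \<open>Apply the hypothesis to a single class: if its argument of \<open>collapse f\<close> is
  not fictitious, the class cannot be invariant, so it expands.\<close>

lemma saturated_monotone_imp_block_monotone:
  assumes "saturated_monotone \<alpha> f"
  shows "block_monotone \<alpha> f"
  unfolding block_monotone_def monotone_fun_def fst_collapse
proof (intro allI impI ballI)
  fix k y
  assume k: "k < length (blocks f)" and fict: "\<not> fictitious (collapse f) k"
    and y: "y \<in> cube (length (blocks f))" "\<not> y ! k"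
  have update: "snd (collapse f) (y[k := True]) = snd f (raise_args (blocks f ! k) (expand f y))"
    if "y \<in> cube (length (blocks f))" for y
    using that expand_update[OF that k] by (subst snd_collapse) (auto simp: cube_def)
  have "\<not> raise_invariant f (blocks f ! k)"
  proof
    assume inv: "raise_invariant f (blocks f ! k)"
    have raise: "snd (collapse f) (z[k := True]) = snd (collapse f) z"
      if z: "z \<in> cube (length (blocks f))" for z
    proof (cases "z ! k")
      case True
      then show ?thesis using list_update_id[of z k] by simp
    next
      case False
      then show ?thesis
        using inv z expand_vanishing[OF k] by (simp add: raise_invariant_def update snd_collapse)
    qed
    have "fictitious (collapse f) k"
      unfolding fictitious_def fst_collapse
    proof (intro ballI impI)
      fix x x' assume x: "x \<in> cube (length (blocks f))" "x' \<in> cube (length (blocks f))"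
        and eq: "\<forall>j<length (blocks f). j \<noteq> k \<longrightarrow> x ! j = x' ! j"
      \<comment> \<open>Points that differ only at \<open>k\<close> become equal once
        \<open>k\<close> is set, so \<open>raise\<close> gives them the same value.\<close>
      have "x[k := True] = x'[k := True]"
        using x eq k by (intro nth_equalityI) (simp_all add: cube_def nth_list_update)
      then show "snd (collapse f) x = snd (collapse f) x'" using raise x by metis
    qed
    with fict show False ..
  qed
  then have "raise_expanding \<alpha> f (blocks f ! k)"
    using assms saturated_block[OF k] by (auto simp: saturated_monotone_def)
  then show "\<alpha> * snd (collapse f) y \<le> snd (collapse f) (y[k := True])"
    using y expand_vanishing[OF k] by (simp add: raise_expanding_def update snd_collapse)
qed

lemma MON_iff:
  assumes "\<alpha> \<ge> 1"
  shows "f \<in> MON \<alpha> \<longleftrightarrow> f \<in> all_bfuns \<and> saturated_monotone \<alpha> f"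
  using block_monotone_imp_saturated_monotone[OF _ assms] saturated_monotone_imp_block_monotone
  unfolding MON_def by blast


section \<open>Closure properties\<close>

definition reindex :: "nat \<Rightarrow> (nat \<Rightarrow> nat) \<Rightarrow> bfun \<Rightarrow> bfun" where
  "reindex n \<sigma> f = mk_bfun n (\<lambda>x. snd f (map (\<lambda>j. x ! \<sigma> j) [0..<fst f]))"

text \<open>Argument \<open>j\<close> of \<open>f\<close> reads variable \<open>\<sigma> j\<close>,
  so raising \<open>V\<close> in the result raises its preimage under \<open>\<sigma>\<close> in
  \<open>f\<close>. The preimage is saturated because \<open>\<sigma>\<close> carries
  \<open>arg_rel f\<close> into the relation of the result.\<close>

lemma reindex_MON:
  assumes \<alpha>: "\<alpha> \<ge> 1" and f: "f \<in> MON \<alpha>" and \<sigma>: "\<And>j. j < fst f \<Longrightarrow> \<sigma> j < n"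
  shows "reindex n \<sigma> f \<in> MON \<alpha>"
proof -
  let ?g = "reindex n \<sigma> f" and ?r = "\<lambda>x. map (\<lambda>j. x ! \<sigma> j) [0..<fst f]"
  have fb: "f \<in> all_bfuns" and fs: "saturated_monotone \<alpha> f"
    using f MON_iff[OF \<alpha>] by auto
  have [simp]: "?r x \<in> cube (fst f)" "fst ?g = n" for x
    by (simp_all add: cube_def reindex_def)
  have g: "snd ?g x = snd f (?r x)" if "x \<in> cube n" for x
    using that by (simp add: reindex_def snd_mk_bfun)
  have "raise_invariant ?g V \<or> raise_expanding \<alpha> ?g V" if V: "saturated ?g V" for V
  proof -
    let ?W = "{j. j < fst f \<and> \<sigma> j \<in> V}"
    have "j' \<in> ?W" if "j \<in> ?W" "(j, j') \<in> arg_rel f" for j j'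
    proof -
      note jj = arg_relD[OF that(2)]
      have "(\<sigma> j, \<sigma> j') \<in> arg_rel ?g"
      proof (rule arg_relI)
        fix x assume x: "x \<in> cube (fst ?g)" "x ! \<sigma> j \<noteq> x ! \<sigma> j'"
        have "snd f (?r x) = 0" by (rule jj(3)) (use x jj(1,2) in simp_all)
        then show "snd ?g x = 0" using g x by simp
      qed (use jj \<sigma> in simp_all)
      then show ?thesis using that V jj unfolding saturated_def by blast
    qed
    then have W: "saturated f ?W" unfolding saturated_def by blast
    have x: "x \<in> cube n" "?r x \<in> vanishing ?W (fst f)"
        "?r (raise_args V x) = raise_args ?W (?r x)"
      if "x \<in> vanishing V n" for x
    proof -
      show "x \<in> cube n" "?r x \<in> vanishing ?W (fst f)"
        using that by (auto simp: vanishing_def)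
      then show "?r (raise_args V x) = raise_args ?W (?r x)"
        using \<sigma> by (intro nth_equalityI) (simp_all add: cube_def)
    qed
    have "raise_invariant ?g V" if "raise_invariant f ?W"
      using that x by (simp add: raise_invariant_def g)
    moreover have "raise_expanding \<alpha> ?g V" if "raise_expanding \<alpha> f ?W"
      using that x by (simp add: raise_expanding_def g)
    ultimately show ?thesis using W fs unfolding saturated_monotone_def by blast
  qed
  then have "saturated_monotone \<alpha> ?g" by (simp add: saturated_monotone_def)
  moreover have "?g \<in> all_bfuns"
    unfolding reindex_def by (intro mk_bfun_in_all_bfuns all_bfuns_nonneg[OF fb]) simp
  ultimately show ?thesis using MON_iff[OF \<alpha>] by blast
qed

text \<open>The increasing injection of the naturals that misses exactly \<open>i\<close>: it sends
  a position to its place after an argument is inserted at \<open>i\<close>.\<close>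

definition skip :: "nat \<Rightarrow> nat \<Rightarrow> nat" where
  "skip i j = (if j < i then j else Suc j)"

lemma mk_bfun_cong: "(\<And>x. x \<in> cube k \<Longrightarrow> f x = g x) \<Longrightarrow> mk_bfun k f = mk_bfun k g"
  by (auto simp: mk_bfun_def restrict_def)

lemma add_arg_MON:
  assumes "\<alpha> \<ge> 1" "f \<in> MON \<alpha>" "i \<le> fst f"
  shows "add_arg i f \<in> MON \<alpha>"
proof -
  have "take i x @ drop (Suc i) x = map (\<lambda>j. x ! skip i j) [0..<fst f]"
    if "x \<in> cube (Suc (fst f))" for x
    using that assms(3) by (auto simp: cube_def list_eq_iff_nth_eq nth_append skip_def)
  then have "add_arg i f = reindex (Suc (fst f)) (skip i) f"
    unfolding add_arg_def reindex_def by (intro mk_bfun_cong) simp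
  then show ?thesis using reindex_MON[OF assms(1,2)] by (simp add: skip_def)
qed

lemma permute_args_MON:
  assumes "\<alpha> \<ge> 1" "f \<in> MON \<alpha>" "p permutes {..<fst f}"
  shows "permute_args p f \<in> MON \<alpha>"
proof -
  have "permute_args p f = reindex (fst f) p f"
    unfolding permute_args_def reindex_def
    by (intro mk_bfun_cong) (simp add: permute_list_def cube_def)
  then show ?thesis
    using reindex_MON[OF assms(1,2)] permutes_in_image[OF assms(3)] by simp
qed

section \<open>Pointwise products\<close>

lemma mult_bfun_MON:
  assumes \<alpha>: "\<alpha> \<ge> 1" and f: "f \<in> MON \<alpha>" and g: "g \<in> MON \<alpha>" and arity: "fst f = fst g"
  shows "mult_bfun f g \<in> MON \<alpha>"
proof -
  let ?h = "mult_bfun f g"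
  have fb: "f \<in> all_bfuns" and fs: "saturated_monotone \<alpha> f"
    and gb: "g \<in> all_bfuns" and gs: "saturated_monotone \<alpha> g"
    using f g MON_iff[OF \<alpha>] by auto
  have [simp]: "fst ?h = fst g" by (simp add: mult_bfun_def arity)
  have h: "snd ?h x = snd f x * snd g x" if "x \<in> cube (fst g)" for x
    using that by (simp add: mult_bfun_def snd_mk_bfun arity)
  have fpos: "0 \<le> snd f x" and gpos: "0 \<le> snd g x" if "x \<in> cube (fst g)" for x
    using that all_bfuns_nonneg[OF fb] all_bfuns_nonneg[OF gb] arity by auto
  have "raise_invariant ?h V \<or> raise_expanding \<alpha> ?h V" if V: "saturated ?h V" for V
  proof -
    \<comment> \<open>Zeros of a factor are zeros of the product, so the relation can only grow, and
      a set saturated for the product is saturated for both factors.\<close>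
    have "arg_rel f \<subseteq> arg_rel ?h" "arg_rel g \<subseteq> arg_rel ?h"
      by (auto simp: arg_rel_def h arity)
    then have "saturated f V" "saturated g V"
      using V arity unfolding saturated_def by (simp, blast)+
    then have Vf: "raise_invariant f V \<or> raise_expanding \<alpha> f V"
      and Vg: "raise_invariant g V \<or> raise_expanding \<alpha> g V"
      using fs gs by (auto simp: saturated_monotone_def)
    \<comment> \<open>If one factor expands, the other does not decrease by
      \<open>raise_mono\<close>, and nonnegativity allows the two inequalities to be
      multiplied.\<close>
    consider "raise_invariant f V" "raise_invariant g V"
      | "raise_expanding \<alpha> f V" | "raise_expanding \<alpha> g V"
      using Vf Vg by blast
    then show ?thesis
    proof cases
      case 1
      then have "raise_invariant ?h V"
        by (simp add: raise_invariant_def h arity vanishingD)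
      then show ?thesis ..
    next
      case 2
      have "raise_expanding \<alpha> ?h V"
        unfolding raise_expanding_def
      proof
        fix x assume "x \<in> vanishing V (fst ?h)"
        then have x: "x \<in> vanishing V (fst g)" "x \<in> cube (fst g)"
          by (auto dest: vanishingD)
        have "(\<alpha> * snd f x) * snd g x \<le> snd f (raise_args V x) * snd g (raise_args V x)"
          using 2 x raise_mono[OF gb \<alpha> Vg] fpos gpos
          by (intro mult_mono) (auto simp: raise_expanding_def arity)
        then show "\<alpha> * snd ?h x \<le> snd ?h (raise_args V x)"
          using x by (simp add: h mult.assoc)
      qed
      then show ?thesis ..
    next
      case 3
      have "raise_expanding \<alpha> ?h V"
        unfolding raise_expanding_def
      proof
        fix x assume "x \<in> vanishing V (fst ?h)"
        then have x: "x \<in> vanishing V (fst g)" "x \<in> cube (fst g)"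
          by (auto dest: vanishingD)
        have "snd f x * (\<alpha> * snd g x) \<le> snd f (raise_args V x) * snd g (raise_args V x)"
          using 3 x raise_mono[OF fb \<alpha> Vf] fpos gpos \<alpha>
          by (intro mult_mono) (auto simp: raise_expanding_def arity)
        then show "\<alpha> * snd ?h x \<le> snd ?h (raise_args V x)"
          using x by (simp add: h mult.left_commute)
      qed
      then show ?thesis ..
    qed
  qed
  then have "saturated_monotone \<alpha> ?h" by (simp add: saturated_monotone_def)
  moreover have "?h \<in> all_bfuns"
    unfolding mult_bfun_def arity by (intro mk_bfun_in_all_bfuns mult_nonneg_nonneg fpos gpos)
  ultimately show ?thesis using MON_iff[OF \<alpha>] by blast
qed

section \<open>Summing out an argument\<close>

definition insert_arg :: "nat \<Rightarrow> bool \<Rightarrow> bool list \<Rightarrow> bool list" where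
  "insert_arg i b x = take i x @ b # drop i x"

lemma length_insert_arg [simp]: "length (insert_arg i b x) = Suc (length x)"
  by (simp add: insert_arg_def)

lemma nth_insert_arg_self [simp]: "i \<le> length x \<Longrightarrow> insert_arg i b x ! i = b"
  by (simp add: insert_arg_def nth_append)

lemma nth_insert_arg_skip [simp]:
  "i \<le> length x \<Longrightarrow> j < length x \<Longrightarrow> insert_arg i b x ! skip i j = x ! j"
  by (auto simp: insert_arg_def nth_append nth_Cons' skip_def)

lemma skip_cases:
  assumes "i \<le> n" "j < Suc n"
  obtains "j = i" | k where "k < n" "j = skip i k"
proof -
  have "j = i \<or> (\<exists>k<n. j = skip i k)"
  proof (cases j i rule: linorder_cases)
    case less
    then show ?thesis using assms by (intro disjI2 exI[of _ j]) (simp add: skip_def)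
  next
    case greater
    then show ?thesis using assms by (intro disjI2 exI[of _ "j - 1"]) (auto simp: skip_def)
  qed simp
  then show ?thesis using that by blast
qed

lemma list_eq_by_skip:
  assumes "length xs = Suc n" "length ys = Suc n" "i \<le> n"
    and "xs ! i = ys ! i" "\<And>k. k < n \<Longrightarrow> xs ! skip i k = ys ! skip i k"
  shows "xs = ys"
proof (rule nth_equalityI)
  fix j assume "j < length xs"
  then have "j < Suc n" using assms(1) by simp
  then show "xs ! j = ys ! j" by (rule skip_cases[OF assms(3)]) (simp_all only: assms)
qed (use assms in simp)

lemma skip_image_iff [simp]: "skip i k \<in> skip i ` V \<longleftrightarrow> k \<in> V"
  by (rule inj_image_mem_iff) (auto simp: inj_def skip_def split: if_splits)

lemma skip_neq [simp]: "skip i k \<noteq> i" "i \<noteq> skip i k"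
  by (auto simp: skip_def)

lemma skip_less: "k < n \<Longrightarrow> skip i k < Suc n"
  by (simp add: skip_def)

lemma sum_out_MON:
  assumes \<alpha>: "\<alpha> \<ge> 1" and f: "f \<in> MON \<alpha>" and i: "i < fst f"
  shows "sum_out i f \<in> MON \<alpha>"
proof -
  let ?g = "sum_out i f"
  define n where "n = fst f - 1"
  have fn: "fst f = Suc n" and in_: "i \<le> n" using i by (auto simp: n_def)
  have fb: "f \<in> all_bfuns" and fs: "saturated_monotone \<alpha> f"
    using f MON_iff[OF \<alpha>] by auto
  have [simp]: "fst ?g = n" by (simp add: sum_out_def n_def)
  have ins: "insert_arg i b x \<in> cube (Suc n)" if "x \<in> cube n" for x b
    using that by (simp add: cube_def)
  have pos: "0 \<le> snd f (insert_arg i b x)" if "x \<in> cube n" for x b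
    using all_bfuns_nonneg[OF fb] ins[OF that] by (simp add: fn)
  have g: "snd ?g x = snd f (insert_arg i False x) + snd f (insert_arg i True x)"
    if "x \<in> cube n" for x
    using that by (simp add: sum_out_def snd_mk_bfun n_def insert_arg_def UNIV_bool)
  have rel: "(j, k) \<in> arg_rel ?g" if jk: "(skip i j, skip i k) \<in> arg_rel f" "j < n" "k < n" for j k
  proof (rule arg_relI)
    fix x assume x: "x \<in> cube (fst ?g)" "x ! j \<noteq> x ! k"
    then have len: "length x = n" by (simp add: cube_def)
    have "snd f (insert_arg i b x) = 0" for b
    proof (rule arg_relD(3)[OF jk(1)])
      show "insert_arg i b x \<in> cube (fst f)" using len by (simp add: cube_def fn)
      show "insert_arg i b x ! skip i j \<noteq> insert_arg i b x ! skip i k"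
        using x jk len in_ by simp
    qed
    then show "snd ?g x = 0" using x by (simp add: g)
  qed (use jk in simp_all)
  have "raise_invariant ?g V \<or> raise_expanding \<alpha> ?g V" if V: "saturated ?g V" for V
  proof -
    have Vn: "V \<subseteq> {..<n}" using V by (simp add: saturated_def)
    have closed: "k \<in> V" if "j \<in> V" "(skip i j, skip i k) \<in> arg_rel f" "k < n" for j k
      using V rel[OF that(2)] that Vn by (auto simp: saturated_def)
    \<comment> \<open>The lift is closed under \<open>arg_rel f\<close> except possibly for
      \<open>i\<close>, which the case split decides.\<close>
    have closed': "m \<in> skip i ` V" if "j \<in> V" "(skip i j, m) \<in> arg_rel f" and ne: "m \<noteq> i" for j m
    proof -
      have "m < Suc n" using arg_relD(2)[OF that(2)] fn by simp
      then obtain k where "k < n" "m = skip i k"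
        by (rule skip_cases[OF in_]) (use ne in blast)+
      then show ?thesis using closed[OF that(1)] that(2) by blast
    qed
    show ?thesis
    proof (cases "\<exists>j\<in>V. (skip i j, i) \<in> arg_rel f")
      case False
      have sat: "saturated f (skip i ` V)"
        unfolding saturated_def
      proof
        show "skip i ` V \<subseteq> {..<fst f}" using Vn fn by (auto intro: skip_less)
        show "arg_rel f `` skip i ` V \<subseteq> skip i ` V" using closed' False by blast
      qed
      have x: "x \<in> cube n" "insert_arg i b x \<in> vanishing (skip i ` V) (fst f)"
          "insert_arg i b (raise_args V x) = raise_args (skip i ` V) (insert_arg i b x)"
        if x: "x \<in> vanishing V n" for x b
      proof -
        show "x \<in> cube n" using x by (rule vanishingD)
        then have len: "length x = n" by (simp add: cube_def)
        show "insert_arg i b x \<in> vanishing (skip i ` V) (fst f)"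
          unfolding vanishing_def
        proof (intro CollectI conjI ballI)
          show "insert_arg i b x \<in> cube (fst f)" using ins \<open>x \<in> cube n\<close> fn by simp
          fix m assume "m \<in> skip i ` V"
          then obtain j where j: "j \<in> V" "m = skip i j" by blast
          have "insert_arg i b x ! m = x ! j"
            unfolding j(2) by (rule nth_insert_arg_skip) (use len in_ j(1) Vn in auto)
          then show "\<not> insert_arg i b x ! m" using x j(1) by (simp add: vanishing_def)
        qed
        show "insert_arg i b (raise_args V x) = raise_args (skip i ` V) (insert_arg i b x)"
        proof (rule list_eq_by_skip[OF _ _ in_])
          fix k assume k: "k < n"
          then show "insert_arg i b (raise_args V x) ! skip i k
              = raise_args (skip i ` V) (insert_arg i b x) ! skip i k"
            using len in_ skip_less[of k n i] by simp
        next
          have "i \<notin> skip i ` V" by auto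
          then show "insert_arg i b (raise_args V x) ! i
              = raise_args (skip i ` V) (insert_arg i b x) ! i"
            using len in_ by simp
        qed (simp_all add: len)
      qed
      have "raise_invariant ?g V" if "raise_invariant f (skip i ` V)"
        using that x by (simp add: raise_invariant_def g)
      moreover have "raise_expanding \<alpha> ?g V" if "raise_expanding \<alpha> f (skip i ` V)"
        using that x by (simp add: raise_expanding_def g distrib_left add_mono)
      ultimately show ?thesis using sat fs unfolding saturated_monotone_def by blast
    next
      case True
      then obtain j where j: "j \<in> V" "(skip i j, i) \<in> arg_rel f" by blast
      let ?W = "insert i (skip i ` V)"
      \<comment> \<open>Whatever is related to \<open>i\<close> is related to the lift already, so
        adjoining \<open>i\<close> alone closes the set.\<close>
      have tr: "(skip i j, m) \<in> arg_rel f" if "(i, m) \<in> arg_rel f" for m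
        using j(2) that equiv_arg_rel[of f] by (meson equivE transE)
      have sat: "saturated f ?W"
        unfolding saturated_def
      proof
        show "?W \<subseteq> {..<fst f}" using Vn fn in_ by (auto intro: skip_less)
        show "arg_rel f `` ?W \<subseteq> ?W" using closed' tr j(1) by blast
      qed
      have jn: "j < n" using j(1) Vn by blast
      \<comment> \<open>Only the summand whose inserted bit equals \<open>x ! j\<close> can be
        nonzero.\<close>
      have zero: "snd f (insert_arg i b x) = 0" if "x \<in> cube n" "x ! j \<noteq> b" for x b
      proof (rule arg_relD(3)[OF j(2)])
        show "insert_arg i b x \<in> cube (fst f)" using ins that(1) fn by simp
        show "insert_arg i b x ! skip i j \<noteq> insert_arg i b x ! i"
          using that jn in_ by (simp add: cube_def)
      qed
      have x: "insert_arg i False x \<in> vanishing ?W (fst f)"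
          "snd ?g x = snd f (insert_arg i False x)"
          "snd ?g (raise_args V x) = snd f (raise_args ?W (insert_arg i False x))"
        if x: "x \<in> vanishing V n" for x
      proof -
        have c: "x \<in> cube n" using x by (rule vanishingD)
        then have len: "length x = n" by (simp add: cube_def)
        have xj: "\<not> x ! j" using x j(1) by (simp add: vanishing_def)
        show "insert_arg i False x \<in> vanishing ?W (fst f)"
          unfolding vanishing_def
        proof (intro CollectI conjI ballI)
          show "insert_arg i False x \<in> cube (fst f)" using ins c fn by simp
          fix m assume "m \<in> ?W"
          then consider "m = i" | k where "k \<in> V" "m = skip i k" by blast
          then show "\<not> insert_arg i False x ! m"
          proof cases
            case 2
            have "insert_arg i False x ! m = x ! k"
              unfolding 2(2) by (rule nth_insert_arg_skip) (use len in_ 2(1) Vn in auto)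
            then show ?thesis using x 2(1) by (simp add: vanishing_def)
          qed (use len in_ in simp)
        qed
        show "snd ?g x = snd f (insert_arg i False x)" using g zero c xj by simp
        \<comment> \<open>The surviving bit is False before the raising and True after it, so
          \<open>i\<close> is raised along with \<open>V\<close>.\<close>
        have "insert_arg i True (raise_args V x) = raise_args ?W (insert_arg i False x)"
        proof (rule list_eq_by_skip[OF _ _ in_])
          fix k assume k: "k < n"
          then show "insert_arg i True (raise_args V x) ! skip i k
              = raise_args ?W (insert_arg i False x) ! skip i k"
            using len in_ skip_less[of k n i] by simp
        qed (use len in_ in simp_all)
        moreover have "raise_args V x ! j" using j(1) jn len by simp
        ultimately show
          "snd ?g (raise_args V x) = snd f (raise_args ?W (insert_arg i False x))"
          using g zero c by simp
      qed
      have "raise_invariant ?g V" if "raise_invariant f ?W"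
        using that x by (simp add: raise_invariant_def)
      moreover have "raise_expanding \<alpha> ?g V" if "raise_expanding \<alpha> f ?W"
        using that x by (simp add: raise_expanding_def)
      ultimately show ?thesis using sat fs unfolding saturated_monotone_def by blast
    qed
  qed
  then have "saturated_monotone \<alpha> ?g" by (simp add: saturated_monotone_def)
  moreover have "?g \<in> all_bfuns"
    unfolding sum_out_def
    by (intro mk_bfun_in_all_bfuns sum_nonneg)
      (use pos in \<open>simp add: n_def insert_arg_def\<close>)
  ultimately show ?thesis using MON_iff[OF \<alpha>] by blast
qed

section \<open>The equality function and clones without limits\<close>

lemma EQ_MON:
  assumes \<alpha>: "\<alpha> \<ge> 1"
  shows "EQ \<in> MON \<alpha>"
proof -
  have [simp]: "fst EQ = 2" by (simp add: EQ_def)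
  have E: "snd EQ x = (if x ! 0 = x ! 1 then 1 else 0)" if "x \<in> cube 2" for x
    using that by (simp add: EQ_def snd_mk_bfun)
  have "raise_invariant EQ V" if V: "saturated EQ V" for V
  proof -
    have "(0, 1) \<in> arg_rel EQ" "(1, 0) \<in> arg_rel EQ"
      by (auto intro!: arg_relI simp: E split: if_splits)
    \<comment> \<open>The two arguments form one class; moving both or neither preserves
      equality.\<close>
    then have "0 \<in> V \<longleftrightarrow> 1 \<in> V" using V by (auto simp: saturated_def)
    then show ?thesis
      by (auto simp: raise_invariant_def vanishing_def E) (auto simp: cube_def)
  qed
  moreover have "EQ \<in> all_bfuns"
    unfolding EQ_def by (rule mk_bfun_in_all_bfuns) simp
  ultimately show ?thesis using MON_iff[OF \<alpha>] by (auto simp: saturated_monotone_def)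
qed

lemma clone_MON:
  assumes \<alpha>: "\<alpha> \<ge> 1" and S: "S \<subseteq> MON \<alpha>" and f: "f \<in> clone S"
  shows "f \<in> MON \<alpha>"
  using f
proof induction
  case (base f)
  then show ?case using S by blast
qed (use \<alpha> in \<open>auto intro: EQ_MON add_arg_MON permute_args_MON mult_bfun_MON sum_out_MON\<close>)

section \<open>Limits\<close>

lemma eventually_small_le:
  fixes a b c :: real
  assumes "0 < d" "\<And>e. 0 < e \<Longrightarrow> e < d \<Longrightarrow> a \<le> b + c * e"
  shows "a \<le> b"
proof (rule tendsto_lowerbound)
  show "((\<lambda>e. b + c * e) \<longlongrightarrow> b) (at_right 0)" by (auto intro!: tendsto_eq_intros)
  show "\<forall>\<^sub>F e in at_right 0. a \<le> b + c * e"
    using assms by (auto simp: eventually_at_right intro!: exI[of _ d])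
qed simp

text \<open>Let \<open>V\<close> be saturated but not invariant for \<open>f\<close>. A close
  approximant \<open>g\<close> inherits both properties, hence expands along \<open>V\<close>, and
  its inequality passes to \<open>f\<close> with an error that tends to 0.\<close>

lemma limit_MON:
  assumes \<alpha>: "\<alpha> \<ge> 1" and S: "S \<subseteq> MON \<alpha>" and f: "f \<in> all_bfuns"
    and approx: "approximable S f"
  shows "f \<in> MON \<alpha>"
proof -
  have ex: "\<exists>g \<in> MON \<alpha>. fst g = fst f \<and> (\<forall>x \<in> cube (fst f). \<bar>snd f x - snd g x\<bar> < e)"
    if "e > 0" for e
  proof -
    obtain g where g: "g \<in> clone S" "fst g = fst f"
        "Max ((\<lambda>x. \<bar>snd f x - snd g x\<bar>) ` cube (fst f)) < e"
      using approx \<open>e > 0\<close> unfolding approximable_def by blast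
    have "\<bar>snd f x - snd g x\<bar> < e" if "x \<in> cube (fst f)" for x
    proof -
      have "\<bar>snd f x - snd g x\<bar> \<le> Max ((\<lambda>x. \<bar>snd f x - snd g x\<bar>) ` cube (fst f))"
        using that finite_cube by (intro Max_ge) auto
      with g(3) show ?thesis by simp
    qed
    then show ?thesis using g clone_MON[OF \<alpha> S] by blast
  qed
  \<comment> \<open>A positive lower bound on the nonzero values of \<open>f\<close>; the inserted 1
    keeps the minimum defined when \<open>f\<close> is identically 0.\<close>
  define d where "d = Min (insert 1 {snd f x |x. x \<in> cube (fst f) \<and> snd f x \<noteq> 0})"
  have fin: "finite (insert 1 {snd f x |x. x \<in> cube (fst f) \<and> snd f x \<noteq> 0})"
    using finite_cube by simp
  have d: "d > 0"
    unfolding d_def using all_bfuns_nonneg[OF f] fin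
    by (subst Min_gr_iff) (auto simp: less_le)
  have dle: "d \<le> snd f x" if "x \<in> cube (fst f)" "snd f x \<noteq> 0" for x
    unfolding d_def using that by (intro Min_le[OF fin]) blast
  have "raise_expanding \<alpha> f V" if V: "saturated f V" and inv: "\<not> raise_invariant f V" for V
    unfolding raise_expanding_def
  proof
    fix x assume x: "x \<in> vanishing V (fst f)"
    have xc: "x \<in> cube (fst f)" using x by (rule vanishingD)
    obtain z where z: "z \<in> vanishing V (fst f)" "snd f (raise_args V z) \<noteq> snd f z"
      using inv by (auto simp: raise_invariant_def)
    define \<delta> where "\<delta> = \<bar>snd f (raise_args V z) - snd f z\<bar>"
    have \<delta>: "\<delta> > 0" using z(2) by (simp add: \<delta>_def)
    show "\<alpha> * snd f x \<le> snd f (raise_args V x)"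
    \<comment> \<open>Error below \<open>d\<close> makes \<open>g\<close> nonzero wherever
      \<open>f\<close> is; error below \<open>\<delta> / 2\<close> at both points keeps
      \<open>g\<close> from being equal at \<open>z\<close> and at its raising. The factor
      \<open>1 + \<alpha>\<close> collects \<open>\<alpha> * e\<close> from the left side and
      \<open>e\<close> from the right.\<close>
    proof (rule eventually_small_le[where d = "min d (\<delta> / 2)" and c = "1 + \<alpha>"])
      show "0 < min d (\<delta> / 2)" using d \<delta> by simp
      fix e :: real assume e: "0 < e" "e < min d (\<delta> / 2)"
      obtain g where g: "g \<in> MON \<alpha>" and arity: "fst g = fst f"
        and close: "\<And>x. x \<in> cube (fst f) \<Longrightarrow> \<bar>snd f x - snd g x\<bar> < e"
        using ex[OF e(1)] by blast
      have "snd f y = 0" if "y \<in> cube (fst f)" "snd g y = 0" for y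
        using close[OF that(1)] dle[OF that(1)] that(2) e(2) by (cases "snd f y = 0") auto
      then have "arg_rel g \<subseteq> arg_rel f" by (auto simp: arg_rel_def arity)
      then have "saturated g V" using V arity unfolding saturated_def by (simp, blast)
      moreover have "snd g (raise_args V z) \<noteq> snd g z"
        using close[of z] close[of "raise_args V z"] vanishingD[OF z(1)] e(2)
        unfolding \<delta>_def by fastforce
      then have "\<not> raise_invariant g V" using z(1) arity by (auto simp: raise_invariant_def)
      ultimately have "raise_expanding \<alpha> g V"
        using g MON_iff[OF \<alpha>] by (auto simp: saturated_monotone_def)
      then have "\<alpha> * snd g x \<le> snd g (raise_args V x)"
        using x arity by (simp add: raise_expanding_def)
      moreover have "\<alpha> * snd f x \<le> \<alpha> * (snd g x + e)"
        using close[OF xc] \<alpha> by (intro mult_left_mono) auto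
      moreover have "snd g (raise_args V x) \<le> snd f (raise_args V x) + e"
        using close[of "raise_args V x"] xc by simp
      ultimately show "\<alpha> * snd f x \<le> snd f (raise_args V x) + (1 + \<alpha>) * e"
        by (simp add: algebra_simps)
    qed
  qed
  then show ?thesis using f MON_iff[OF \<alpha>] by (auto simp: saturated_monotone_def)
qed

section \<open>Functions of arity 0, and the closure theorem\<close>

lemma bfuns_0_MON:
  assumes \<alpha>: "\<alpha> \<ge> 1"
  shows "bfuns 0 \<subseteq> MON \<alpha>"
proof
  fix f assume f: "f \<in> bfuns 0"
  then have "fst f = 0" "f \<in> all_bfuns" by (auto simp: bfuns_def all_bfuns_def)
  \<comment> \<open>Without arguments the empty set is the only saturated set, and it is
    invariant.\<close>
  then show "f \<in> MON \<alpha>"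
    using MON_iff[OF \<alpha>] raise_invariant_empty
    by (auto simp: saturated_monotone_def saturated_def)
qed

theorem theorem10p3:
  fixes \<alpha> :: real
  assumes "\<alpha> \<ge> 1"
  shows "omega_clone (MON \<alpha>) = MON \<alpha> \<and> bfuns 0 \<subseteq> MON \<alpha>"
proof (intro conjI equalityI subsetI)
  fix f assume "f \<in> omega_clone (MON \<alpha>)"
  then show "f \<in> MON \<alpha>"
  proof induction
    \<comment> \<open>The induction hypothesis puts all of \<open>S\<close> inside
      \<open>MON \<alpha>\<close>.\<close>
    case (limit f S)
    then show ?case using limit_MON[OF assms, of S f] by blast
  qed (use assms in \<open>auto intro: EQ_MON add_arg_MON permute_args_MON mult_bfun_MON sum_out_MON\<close>)
qed (use bfuns_0_MON[OF assms] in \<open>auto intro: omega_clone.base\<close>)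

end
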